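(* Let $\Sigma\subset\mathbb{E}_1^3$ be a regular spacelike ($\epsilon=-1$) or timelike ($\epsilon=+1$) surface with unit normal $N$, and let $p\in\Sigma$ be a point at which the shape operator $A_p=-dN$ is diagonalizable with orthonormal non-lightlike eigenvectors $\mathbf u_1,\mathbf u_2$ and eigenvalues $\kappa_1,\kappa_2$ (in the timelike case $\mathbf u_1$ is spacelike and $\mathbf u_2$ timelike). Let $H=\frac{\epsilon}{2}(\kappa_1+\kappa_2)$ and $S=\sqrt{(\kappa_1-\kappa_2)^2}$ be the mean and skew curvatures at $p$. Then the expected value $\langle\kappa_n\rangle$ and standard deviation $\sqrt{\langle(\Delta\kappa_n)^2\rangle}$ of the normal curvature $\kappa_n$ at $p$ satisfy $$H=\epsilon\,\langle\kappa_n\rangle\qquad\text{and}\qquad S=2\sqrt2\,\sqrt{\langle(\Delta\kappa_n)^2\rangle}.$$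
   Context: $\mathbb{E}_1^3$ is $\mathbb{R}^3$ with the metric $\langle u,v\rangle=u_1v_1+u_2v_2-u_3v_3$, and $\epsilon=\langle N,N\rangle$. The normal curvature in the direction of a unit tangent vector $\mathbf v$ at $p$ is $\kappa_n(\mathbf v)=\langle A_p\mathbf v,\mathbf v\rangle$. Spacelike case: with $\mathbf v(\phi)=\cos\phi\,\mathbf u_1+\sin\phi\,\mathbf u_2$ and $\kappa_n(\phi)=\kappa_n(\mathbf v(\phi))$, averages are taken with respect to the uniform density: $\langle f\rangle=\int_0^{2\pi}f(\phi)\frac{d\phi}{2\pi}$, and $\langle(\Delta\kappa_n)^2\rangle=\langle(\kappa_n-\langle\kappa_n\rangle)^2\rangle=\langle\kappa_n^2\rangle-\langle\kappa_n\rangle^2$. Timelike case: one restricts to the branch $\mathbf v(\phi)=\cosh\phi\,\mathbf u_1+\sinh\phi\,\mathbf u_2$, $\phi\in\mathbb{R}$, puts $\kappa_n(\phi)=\kappa_n(\mathbf v(\phi))$, and defines $\langle f\rangle$ as the finite part, as $a\to\infty$, of $\frac1{2a}\int_{-a}^{a}f(\phi)\,d\phi$; for the functions involved this average equals $c+\frac{c'\sinh 2a}{a}+\frac{c''\sinh4a}{a}$ with constants $c,c',c''$, and the finite part is $c$. Then $\langle(\Delta\kappa_n)^2\rangle=\langle\kappa_n^2\rangle-\langle\kappa_n\rangle^2$. *)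

theory Defs
  imports "HOL-Analysis.Analysis"
begin

definition lorentz :: "real^3 \<Rightarrow> real^3 \<Rightarrow> real" where
  "lorentz u v = u $ 1 * v $ 1 + u $ 2 * v $ 2 - u $ 3 * v $ 3"

(* For open S: k times continuously differentiable, via iterated partial derivatives. *)
primrec Ck_on :: "nat \<Rightarrow> ('a::euclidean_space \<Rightarrow> 'b::real_normed_vector) \<Rightarrow> 'a set \<Rightarrow> bool" where
  "Ck_on 0 f S \<longleftrightarrow> continuous_on S f"
| "Ck_on (Suc k) f S \<longleftrightarrow>
     f differentiable_on S \<and> (\<forall>b\<in>Basis. Ck_on k (\<lambda>x. frechet_derivative f (at x) b) S)"

definition smooth_on :: "('a::euclidean_space \<Rightarrow> 'b::real_normed_vector) \<Rightarrow> 'a set \<Rightarrow> bool" where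
  "smooth_on f S \<longleftrightarrow> open S \<and> (\<forall>k. Ck_on k f S)"

definition regular_surface :: "(real^3) set \<Rightarrow> bool" where
  "regular_surface \<Sigma> \<longleftrightarrow>
     (\<forall>p\<in>\<Sigma>. \<exists>(X :: real^2 \<Rightarrow> real^3) Y U V.
        open U \<and> open V \<and> p \<in> V \<and>
        homeomorphism U (\<Sigma> \<inter> V) X Y \<and>
        smooth_on X U \<and>
        (\<forall>q\<in>U. inj (frechet_derivative X (at q))))"

definition tangent_plane :: "(real^3) set \<Rightarrow> real^3 \<Rightarrow> (real^3) set" where
  "tangent_plane \<Sigma> p =
     {v. \<exists>(\<alpha> :: real \<Rightarrow> real^3) \<delta>. \<delta> > 0 \<and> smooth_on \<alpha> {-\<delta><..<\<delta>} \<and> \<alpha> ` {-\<delta><..<\<delta>} \<subseteq> \<Sigma> \<and>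
           \<alpha> 0 = p \<and> (\<alpha> has_vector_derivative v) (at 0)}"

definition spacelike_surface :: "(real^3) set \<Rightarrow> bool" where
  "spacelike_surface \<Sigma> \<longleftrightarrow> regular_surface \<Sigma> \<and>
     (\<forall>p\<in>\<Sigma>. \<forall>v\<in>tangent_plane \<Sigma> p. v \<noteq> 0 \<longrightarrow> lorentz v v > 0)"

(* The induced metric is Lorentzian: nondegenerate and indefinite. *)
definition timelike_surface :: "(real^3) set \<Rightarrow> bool" where
  "timelike_surface \<Sigma> \<longleftrightarrow> regular_surface \<Sigma> \<and>
     (\<forall>p\<in>\<Sigma>.
        (\<forall>v\<in>tangent_plane \<Sigma> p. (\<forall>w\<in>tangent_plane \<Sigma> p. lorentz v w = 0) \<longrightarrow> v = 0) \<and>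
        (\<exists>v\<in>tangent_plane \<Sigma> p. lorentz v v > 0) \<and>
        (\<exists>v\<in>tangent_plane \<Sigma> p. lorentz v v < 0))"

(* Differentiability within the subset is differentiability on the surface. *)
definition unit_normal :: "(real^3) set \<Rightarrow> real \<Rightarrow> (real^3 \<Rightarrow> real^3) \<Rightarrow> bool" where
  "unit_normal \<Sigma> \<epsilon> N \<longleftrightarrow> N differentiable_on \<Sigma> \<and>
     (\<forall>p\<in>\<Sigma>. (\<forall>v\<in>tangent_plane \<Sigma> p. lorentz (N p) v = 0) \<and> lorentz (N p) (N p) = \<epsilon>)"

(* The derivative within the surface is determined by N exactly on the tangent plane;
   the shape operator is meaningful only for tangent v. *)
definition shape_operator :: "(real^3) set \<Rightarrow> (real^3 \<Rightarrow> real^3) \<Rightarrow> real^3 \<Rightarrow> real^3 \<Rightarrow> real^3" where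
  "shape_operator \<Sigma> N p v = - frechet_derivative N (at p within \<Sigma>) v"

definition normal_curvature :: "(real^3) set \<Rightarrow> (real^3 \<Rightarrow> real^3) \<Rightarrow> real^3 \<Rightarrow> real^3 \<Rightarrow> real" where
  "normal_curvature \<Sigma> N p v = lorentz (shape_operator \<Sigma> N p v) v"

definition circle_average :: "(real \<Rightarrow> real) \<Rightarrow> real" where
  "circle_average f = integral {0..2*pi} (\<lambda>\<phi>. f \<phi> / (2*pi))"

(* The coefficient c is unique, since 1, sinh (2a) / a and sinh (4a) / a are linearly independent
   on every neighbourhood of infinity. *)
definition finite_part :: "(real \<Rightarrow> real) \<Rightarrow> real" where
  "finite_part g =
     (THE c. \<exists>c' c''. \<forall>\<^sub>F a in at_top. g a = c + c' * sinh (2*a) / a + c'' * sinh (4*a) / a)"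

definition hyperbola_average :: "(real \<Rightarrow> real) \<Rightarrow> real" where
  "hyperbola_average f = finite_part (\<lambda>a. 1 / (2*a) * integral {-a..a} f)"

(* In the following, \<epsilon> = -1 is the spacelike case, otherwise (\<epsilon> = 1) timelike. *)

definition unit_direction :: "real \<Rightarrow> real^3 \<Rightarrow> real^3 \<Rightarrow> real \<Rightarrow> real^3" where
  "unit_direction \<epsilon> u1 u2 \<phi> =
     (if \<epsilon> = -1 then cos \<phi> *\<^sub>R u1 + sin \<phi> *\<^sub>R u2 else cosh \<phi> *\<^sub>R u1 + sinh \<phi> *\<^sub>R u2)"

definition average :: "real \<Rightarrow> (real \<Rightarrow> real) \<Rightarrow> real" where
  "average \<epsilon> f = (if \<epsilon> = -1 then circle_average f else hyperbola_average f)"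

definition mean_square_deviation :: "real \<Rightarrow> (real \<Rightarrow> real) \<Rightarrow> real" where
  "mean_square_deviation \<epsilon> f =
     (if \<epsilon> = -1 then average \<epsilon> (\<lambda>\<phi>. (f \<phi> - average \<epsilon> f)\<^sup>2)
      else average \<epsilon> (\<lambda>\<phi>. (f \<phi>)\<^sup>2) - (average \<epsilon> f)\<^sup>2)"

end

theory Submission
  imports Defs "HOL-Real_Asymp.Real_Asymp"
begin

(* In both cases the normal curvature is a trigonometric (Euler) or hyperbolic polynomial
   m + d cos 2\<phi> resp. m + d cosh 2\<phi> with m = (\<kappa>1 + \<kappa>2) / 2 and d = (\<kappa>1 - \<kappa>2) / 2. The average
   kills the frequencies 2 and 4, so the mean is m and, by the double angle formula, the variance
   is d^2 / 2. In the hyperbolic case the finite part is unambiguous because of the distinct growth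
   rates of sinh 4a, sinh 2a and a. *)

text \<open>The coefficients are peeled off from the fastest growth downwards: in the limit,
  division by \<open>exp (4*a)\<close> isolates \<open>c''/2\<close>, then division by
  \<open>exp (2*a)\<close> isolates \<open>c'/2\<close>, and what remains is
  \<open>c * a = 0\<close>.\<close>

lemma sinh_combination_zero:
  fixes c c' c'' :: real
  assumes "\<forall>\<^sub>F a in at_top. c + c' * sinh (2*a) / a + c'' * sinh (4*a) / a = 0"
  shows "c = 0"
proof -
  have ev: "\<forall>\<^sub>F a in at_top. c * a + c' * sinh (2*a) + c'' * sinh (4*a) = 0"
    using assms eventually_gt_at_top[of "0::real"]
    by eventually_elim (simp add: field_simps)
  \<comment> \<open>The numerator is eventually 0, so the quotient tends to 0 for every normalizer
    \<open>g\<close>, and uniqueness of limits forces any other computed limit to vanish.\<close>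
  have zero: "l = 0" if "((\<lambda>a::real. (c * a + c' * sinh (2*a) + c'' * sinh (4*a)) / g a) \<longlongrightarrow> l) at_top"
    for g :: "real \<Rightarrow> real" and l
  proof (rule tendsto_unique[OF _ that])
    show "((\<lambda>a. (c * a + c' * sinh (2*a) + c'' * sinh (4*a)) / g a) \<longlongrightarrow> 0) at_top"
      by (rule tendsto_eventually) (use ev in eventually_elim, simp)
  qed simp
  have "((\<lambda>a::real. c * (a / exp (4*a)) + c' * (sinh (2*a) / exp (4*a)) + c'' * (sinh (4*a) / exp (4*a)))
      \<longlongrightarrow> c * 0 + c' * 0 + c'' * (1/2)) at_top"
    by (intro tendsto_add tendsto_mult tendsto_const) real_asymp+
  then have c'': "c'' = 0"
    using zero[of "\<lambda>a. exp (4*a)" "c''/2"] by (simp add: add_divide_distrib)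
  have "((\<lambda>a::real. c * (a / exp (2*a)) + c' * (sinh (2*a) / exp (2*a)))
      \<longlongrightarrow> c * 0 + c' * (1/2)) at_top"
    by (intro tendsto_add tendsto_mult tendsto_const) real_asymp+
  then have c': "c' = 0"
    using zero[of "\<lambda>a. exp (2*a)" "c'/2"] c'' by (simp add: add_divide_distrib)
  from ev have "\<forall>\<^sub>F a::real in at_top. c * a = 0"
    by (simp add: c' c'')
  then have "\<forall>\<^sub>F a::real in at_top. c = 0"
    using eventually_gt_at_top[of "0::real"] by eventually_elim simp
  then show ?thesis
    by simp
qed

text \<open>Exhibiting one expansion is enough to evaluate the definite description: the difference
  of two expansions of \<open>g\<close> is an expansion of zero, whose constant term
  vanishes.\<close>

lemma finite_part_eqI:
  assumes "\<forall>\<^sub>F a in at_top. g a = c + c' * sinh (2*a) / a + c'' * sinh (4*a) / a"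
  shows "finite_part g = c"
  unfolding finite_part_def
proof (rule the_equality)
  show "\<exists>c' c''. \<forall>\<^sub>F a in at_top. g a = c + c' * sinh (2*a) / a + c'' * sinh (4*a) / a"
    using assms by blast
next
  fix b assume "\<exists>b' b''. \<forall>\<^sub>F a in at_top. g a = b + b' * sinh (2*a) / a + b'' * sinh (4*a) / a"
  then obtain b' b'' where
    "\<forall>\<^sub>F a in at_top. g a = b + b' * sinh (2*a) / a + b'' * sinh (4*a) / a"
    by blast
  with assms have "\<forall>\<^sub>F a in at_top.
      (b - c) + (b' - c') * sinh (2*a) / a + (b'' - c'') * sinh (4*a) / a = 0"
    by eventually_elim (simp add: left_diff_distrib diff_divide_distrib)
  from sinh_combination_zero[OF this] show "b = c"
    by simp
qed

lemma hyperbola_average_cosh_polynomial: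
  "hyperbola_average (\<lambda>\<phi>. A + B * cosh (2*\<phi>) + C * cosh (4*\<phi>)) = A"
  unfolding hyperbola_average_def
proof (rule finite_part_eqI)
  show "\<forall>\<^sub>F a in at_top. 1 / (2*a) * integral {-a..a} (\<lambda>\<phi>. A + B * cosh (2*\<phi>) + C * cosh (4*\<phi>))
      = A + B/2 * sinh (2*a) / a + C/4 * sinh (4*a) / a"
    using eventually_gt_at_top[of "0::real"]
  proof eventually_elim
    case (elim a)
    \<comment> \<open>This antiderivative is odd, so the integral is \<open>2 * ?F a\<close>; the
      factor 2 cancels against \<open>1 / (2*a)\<close>.\<close>
    let ?F = "\<lambda>\<phi>::real. A * \<phi> + B/2 * sinh (2*\<phi>) + C/4 * sinh (4*\<phi>)"
    have "((\<lambda>\<phi>. A + B * cosh (2*\<phi>) + C * cosh (4*\<phi>)) has_integral ?F a - ?F (-a)) {-a..a}"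
      by (rule fundamental_theorem_of_calculus)
        (use elim in \<open>auto intro!: derivative_eq_intros
          simp flip: has_real_derivative_iff_has_vector_derivative\<close>)
    then have "integral {-a..a} (\<lambda>\<phi>. A + B * cosh (2*\<phi>) + C * cosh (4*\<phi>)) = ?F a - ?F (-a)"
      by (rule integral_unique)
    then show ?case
      using elim by (simp add: field_simps)
  qed
qed

lemma circle_average_cos_polynomial:
  "circle_average (\<lambda>\<phi>. A + B * cos (2*\<phi>) + C * cos (4*\<phi>)) = A"
proof -
  let ?F = "\<lambda>\<phi>::real. (A * \<phi> + B/2 * sin (2*\<phi>) + C/4 * sin (4*\<phi>)) / (2*pi)"
  have "((\<lambda>\<phi>. (A + B * cos (2*\<phi>) + C * cos (4*\<phi>)) / (2*pi)) has_integral ?F (2*pi) - ?F 0) {0..2*pi}"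
    by (rule fundamental_theorem_of_calculus)
      (auto intro!: derivative_eq_intros simp: field_simps
        simp flip: has_real_derivative_iff_has_vector_derivative)
  then have "circle_average (\<lambda>\<phi>. A + B * cos (2*\<phi>) + C * cos (4*\<phi>)) = ?F (2*pi) - ?F 0"
    unfolding circle_average_def by (rule integral_unique)
  moreover have "sin (2 * (2 * pi)) = 0" "sin (4 * (2 * pi)) = 0"
    using sin_npi[of 4] sin_npi[of 8] by (simp_all add: mult.commute)
  ultimately show ?thesis
    by simp
qed

lemma average_circle:
  assumes "\<And>\<phi>. f \<phi> = m + d * cos (2*\<phi>)"
  shows "average (-1) f = m" and "mean_square_deviation (-1) f = d\<^sup>2 / 2"
proof -
  \<comment> \<open>The vanishing frequency-4 term puts \<open>f\<close> into the form that the
    averaging lemma rewrites.\<close>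
  have f: "f = (\<lambda>\<phi>. m + d * cos (2*\<phi>) + 0 * cos (4*\<phi>))"
    using assms by auto
  show mean: "average (-1) f = m"
    unfolding average_def f by (simp only: circle_average_cos_polynomial refl if_True)
  have "(f \<phi> - m)\<^sup>2 = d\<^sup>2 / 2 + 0 * cos (2*\<phi>) + d\<^sup>2 / 2 * cos (4*\<phi>)" for \<phi>
  proof -
    have "cos (4*\<phi>) = 2 * (cos (2*\<phi>))\<^sup>2 - 1"
      using cos_double_cos[of "2*\<phi>"] by simp
    then show ?thesis
      by (simp only: assms) (simp add: power2_eq_square field_simps)
  qed
  then show "mean_square_deviation (-1) f = d\<^sup>2 / 2"
    unfolding mean_square_deviation_def mean
    by (simp only: average_def circle_average_cos_polynomial refl if_True)
qed

lemma average_hyperbola: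
  assumes "\<And>\<phi>. f \<phi> = m + d * cosh (2*\<phi>)"
  shows "average 1 f = m" and "mean_square_deviation 1 f = d\<^sup>2 / 2"
proof -
  have one: "((1::real) = -1) = False"
    by simp
  have f: "f = (\<lambda>\<phi>. m + d * cosh (2*\<phi>) + 0 * cosh (4*\<phi>))"
    using assms by auto
  show mean: "average 1 f = m"
    unfolding average_def f by (simp only: hyperbola_average_cosh_polynomial one if_False)
  \<comment> \<open>Here the variance is defined by subtracting the squared mean, so the uncentred
    square is expanded and its constant term carries an extra \<open>m\<^sup>2\<close>.\<close>
  have "(f \<phi>)\<^sup>2 = (m\<^sup>2 + d\<^sup>2 / 2) + 2 * m * d * cosh (2*\<phi>) + d\<^sup>2 / 2 * cosh (4*\<phi>)" for \<phi>
  proof -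
    have "cosh (4*\<phi>) = 2 * (cosh (2*\<phi>))\<^sup>2 - 1"
      using cosh_double_cosh[of "2*\<phi>"] by simp
    then show ?thesis
      by (simp only: assms) (simp add: power2_eq_square field_simps)
  qed
  then have "average 1 (\<lambda>\<phi>. (f \<phi>)\<^sup>2) = m\<^sup>2 + d\<^sup>2 / 2"
    by (simp only: average_def hyperbola_average_cosh_polynomial one if_False)
  then show "mean_square_deviation 1 f = d\<^sup>2 / 2"
    by (simp add: mean_square_deviation_def mean)
qed

text \<open>\<open>frechet_derivative\<close> chooses one of the derivatives within \<Sigma>; each
  of them is linear on the ambient space, although only its values on tangent vectors are
  determined.\<close>

lemma linear_shape_operator:
  assumes "N differentiable (at p within \<Sigma>)"
  shows "linear (shape_operator \<Sigma> N p)"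
proof -
  have "linear (frechet_derivative N (at p within \<Sigma>))"
    using assms frechet_derivative_works has_derivative_linear by blast
  then show ?thesis
    unfolding shape_operator_def by (rule linear_compose_neg)
qed

lemma lorentz_combination:
  "lorentz (a *\<^sub>R u + b *\<^sub>R v) (c *\<^sub>R u + d *\<^sub>R v) =
     a * c * lorentz u u + (a * d + b * c) * lorentz u v + b * d * lorentz v v"
  by (simp add: lorentz_def algebra_simps)

text \<open>Euler's formula with \<open>lorentz u1 u1\<close> and \<open>lorentz u2 u2\<close> left
  symbolic, so that it serves both signatures; orthogonality kills the mixed term.\<close>

lemma normal_curvature_principal_combination:
  assumes "N differentiable (at p within \<Sigma>)" and "lorentz u1 u2 = 0"
    and "shape_operator \<Sigma> N p u1 = \<kappa>1 *\<^sub>R u1" and "shape_operator \<Sigma> N p u2 = \<kappa>2 *\<^sub>R u2"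
  shows "normal_curvature \<Sigma> N p (a *\<^sub>R u1 + b *\<^sub>R u2) =
    \<kappa>1 * a\<^sup>2 * lorentz u1 u1 + \<kappa>2 * b\<^sup>2 * lorentz u2 u2"
proof -
  have "shape_operator \<Sigma> N p (a *\<^sub>R u1 + b *\<^sub>R u2) = (a * \<kappa>1) *\<^sub>R u1 + (b * \<kappa>2) *\<^sub>R u2"
    using linear_shape_operator[OF assms(1)] assms(3,4) by (simp add: linear_add linear_cmul)
  then show ?thesis
    using assms(2)
    by (simp only: normal_curvature_def lorentz_combination) (simp add: power2_eq_square algebra_simps)
qed

theorem mainTheorem9:
  fixes \<Sigma> :: "(real^3) set" and N :: "real^3 \<Rightarrow> real^3" and p u1 u2 :: "real^3"
    and \<epsilon> \<kappa>1 \<kappa>2 H S :: real and \<kappa>n :: "real \<Rightarrow> real"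
  assumes "spacelike_surface \<Sigma> \<and> \<epsilon> = -1 \<or> timelike_surface \<Sigma> \<and> \<epsilon> = 1"
    and "unit_normal \<Sigma> \<epsilon> N"
    and "p \<in> \<Sigma>"
    and "u1 \<in> tangent_plane \<Sigma> p" and "u2 \<in> tangent_plane \<Sigma> p"
    and "lorentz u1 u2 = 0" and "\<bar>lorentz u1 u1\<bar> = 1" and "\<bar>lorentz u2 u2\<bar> = 1"
    and "timelike_surface \<Sigma> \<Longrightarrow> lorentz u1 u1 > 0 \<and> lorentz u2 u2 < 0"
    and "shape_operator \<Sigma> N p u1 = \<kappa>1 *\<^sub>R u1"
    and "shape_operator \<Sigma> N p u2 = \<kappa>2 *\<^sub>R u2"
    and "H = \<epsilon> / 2 * (\<kappa>1 + \<kappa>2)"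
    and "S = sqrt ((\<kappa>1 - \<kappa>2)\<^sup>2)"
    and "\<And>\<phi>. \<kappa>n \<phi> = normal_curvature \<Sigma> N p (unit_direction \<epsilon> u1 u2 \<phi>)"
  shows "H = \<epsilon> * average \<epsilon> \<kappa>n \<and>
         S = 2 * sqrt 2 * sqrt (mean_square_deviation \<epsilon> \<kappa>n)"
proof -
  define m d where "m = (\<kappa>1 + \<kappa>2) / 2" and "d = (\<kappa>1 - \<kappa>2) / 2"
  have "N differentiable (at p within \<Sigma>)"
    using assms(2,3) by (auto simp: unit_normal_def differentiable_on_def)
  note curvature = normal_curvature_principal_combination[OF this assms(6,10,11)]
  have "average \<epsilon> \<kappa>n = m \<and> mean_square_deviation \<epsilon> \<kappa>n = d\<^sup>2 / 2"
    using assms(1)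
  proof (elim disjE conjE)
    assume "spacelike_surface \<Sigma>" and \<epsilon>: "\<epsilon> = -1"
    then have pos: "lorentz v v > 0" if "v \<in> tangent_plane \<Sigma> p" "v \<noteq> 0" for v
      using that assms(3) by (auto simp: spacelike_surface_def)
    \<comment> \<open>The zero vector would violate the normalization; positivity on nonzero tangent
      vectors then removes the absolute values.\<close>
    have "u1 \<noteq> 0" "u2 \<noteq> 0"
      using assms(7,8) by (auto simp: lorentz_def)
    then have u: "lorentz u1 u1 = 1" "lorentz u2 u2 = 1"
      using pos[of u1] pos[of u2] assms(4,5,7,8) by auto
    have "\<kappa>n \<phi> = m + d * cos (2*\<phi>)" for \<phi>
    proof -
      have "\<kappa>n \<phi> = \<kappa>1 * (cos \<phi>)\<^sup>2 + \<kappa>2 * (sin \<phi>)\<^sup>2"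
        by (simp add: assms(14) \<epsilon> unit_direction_def curvature u)
      also have "\<dots> = m + d * cos (2*\<phi>)"
        \<comment> \<open>Both sides become polynomials in \<open>cos \<phi>\<close>; the hyperbolic
          case proceeds likewise with \<open>cosh \<phi>\<close>.\<close>
        by (simp only: m_def d_def sin_squared_eq cos_double_cos) (simp add: field_simps)
      finally show ?thesis .
    qed
    from average_circle[OF this] show ?thesis
      by (simp add: \<epsilon>)
  next
    assume "timelike_surface \<Sigma>" and \<epsilon>: "\<epsilon> = 1"
    \<comment> \<open>The value \<open>-1\<close> on the timelike eigenvector gives the \<kappa>2
      term its minus sign, which matches \<open>sinh_square_eq\<close> and leaves the same
      \<open>m\<close> and \<open>d\<close> as in the circular case.\<close>
    then have u: "lorentz u1 u1 = 1" "lorentz u2 u2 = -1"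
      using assms(7,8,9) by auto
    have "\<kappa>n \<phi> = m + d * cosh (2*\<phi>)" for \<phi>
    proof -
      have "\<kappa>n \<phi> = \<kappa>1 * (cosh \<phi>)\<^sup>2 - \<kappa>2 * (sinh \<phi>)\<^sup>2"
        by (simp add: assms(14) \<epsilon> unit_direction_def curvature u)
      also have "\<dots> = m + d * cosh (2*\<phi>)"
        by (simp only: m_def d_def sinh_square_eq cosh_double_cosh) (simp add: field_simps)
      finally show ?thesis .
    qed
    from average_hyperbola[OF this] show ?thesis
      by (simp add: \<epsilon>)
  qed
  moreover have "H = \<epsilon> * m"
    by (simp add: assms(12) m_def)
  \<comment> \<open>Both sides equal 2 times the absolute value of \<open>d\<close>: the factor
    \<open>sqrt 2\<close> undoes the halving of \<open>d\<^sup>2\<close> in the variance.\<close>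
  moreover have "S = 2 * sqrt 2 * sqrt (d\<^sup>2 / 2)"
    by (simp add: assms(13) d_def real_sqrt_divide)
  ultimately show ?thesis
    by simp
qed

end
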